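(* Let $m,n\in\mathbb{Z}$ with $1\leq m<n\leq 2m$. There exists a graph $G$ such that $\mathrm{gon}_1(G)=m$ and $\mathrm{gon}_2(G)=n$.
   Context: All graphs are finite, connected, loopless multigraphs with nonempty vertex set $V(G)$ and multiset of edges $E(G)$. A divisor on $G$ is an element $D=\sum_v D(v)\cdot v$ of the free abelian group on $V(G)$; its degree is $\deg(D)=\sum_v D(v)$; it is effective if $D(v)\ge 0$ for all $v$. The Laplacian matrix has diagonal entries $\mathrm{val}(v)$ (number of edges incident to $v$) and off-diagonal entries $-|E(v,w)|$ (minus the number of edges between $v$ and $w$). Divisors $D,D'$ are linearly equivalent, $D\sim D'$, if $D-D'$ is in the image of $\mathbb{Z}^{V(G)}$ under the Laplacian. The rank $r(D)$ is $-1$ if $D$ is not equivalent to any effective divisor; otherwise it is the largest integer $r\ge 0$ such that for every effective divisor $E$ of degree $r$, $D-E$ is equivalent to an effective divisor. For an integer $r\ge 1$, the $r$-th gonality is $\mathrm{gon}_r(G)=\min\{\deg(D): D \text{ a divisor on } G,\ r(D)\ge r\}$. *)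

theory Defs
  imports "HOL-Library.Multiset"
begin

text \<open>
  An edge is the set of its two endpoints; parallel edges are repeated elements of the multiset.
\<close>

record 'a multigraph =
  verts :: "'a set"
  edges :: "'a set multiset"

definition adjacency :: "'a multigraph \<Rightarrow> ('a \<times> 'a) set" where
  "adjacency G = {(u, v). {u, v} \<in># edges G}"

definition graph :: "'a multigraph \<Rightarrow> bool" where
  "graph G \<longleftrightarrow>
     finite (verts G) \<and> verts G \<noteq> {} \<and>
     (\<forall>e \<in># edges G. \<exists>u \<in> verts G. \<exists>v \<in> verts G. u \<noteq> v \<and> e = {u, v}) \<and>
     (\<forall>u \<in> verts G. \<forall>v \<in> verts G. (u, v) \<in> (adjacency G)\<^sup>*)"

text \<open>
  The free abelian group on the finite set of vertices is the group of
  integer-valued functions vanishing outside that set.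
\<close>

definition is_divisor :: "'a multigraph \<Rightarrow> ('a \<Rightarrow> int) \<Rightarrow> bool" where
  "is_divisor G D \<longleftrightarrow> (\<forall>v. v \<notin> verts G \<longrightarrow> D v = 0)"

definition deg :: "'a multigraph \<Rightarrow> ('a \<Rightarrow> int) \<Rightarrow> int" where
  "deg G D = (\<Sum>v \<in> verts G. D v)"

definition effective :: "'a multigraph \<Rightarrow> ('a \<Rightarrow> int) \<Rightarrow> bool" where
  "effective G D \<longleftrightarrow> is_divisor G D \<and> (\<forall>v \<in> verts G. 0 \<le> D v)"

definition val :: "'a multigraph \<Rightarrow> 'a \<Rightarrow> nat" where
  "val G v = size {#e \<in># edges G. v \<in> e#}"

definition laplacian :: "'a multigraph \<Rightarrow> 'a \<Rightarrow> 'a \<Rightarrow> int" where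
  "laplacian G v w = (if v = w then int (val G v) else - int (count (edges G) {v, w}))"

definition lin_equiv :: "'a multigraph \<Rightarrow> ('a \<Rightarrow> int) \<Rightarrow> ('a \<Rightarrow> int) \<Rightarrow> bool" where
  "lin_equiv G D D' \<longleftrightarrow>
     (\<exists>f :: 'a \<Rightarrow> int. \<forall>v \<in> verts G. D v - D' v = (\<Sum>w \<in> verts G. laplacian G v w * f w))"

definition equiv_effective :: "'a multigraph \<Rightarrow> ('a \<Rightarrow> int) \<Rightarrow> bool" where
  "equiv_effective G D \<longleftrightarrow> (\<exists>D'. effective G D' \<and> lin_equiv G D D')"

text \<open>
  The greatest element exists whenever it is used: linear equivalence preserves degrees, so
  every admissible \<open>r\<close> is at most the degree of \<open>D\<close>, and \<open>r = 0\<close> is admissible.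
\<close>

definition rank :: "'a multigraph \<Rightarrow> ('a \<Rightarrow> int) \<Rightarrow> int" where
  "rank G D =
     (if \<not> equiv_effective G D then - 1
      else (GREATEST r. 0 \<le> r \<and>
              (\<forall>E. effective G E \<and> deg G E = r \<longrightarrow> equiv_effective G (\<lambda>v. D v - E v))))"

text \<open>
  For \<open>r \<ge> 1\<close> the minimum exists: a divisor of rank at least \<open>r\<close> has degree at least \<open>r\<close>,
  and the divisor with value \<open>r\<close> at every vertex has rank at least \<open>r\<close>.
\<close>

definition gon :: "int \<Rightarrow> 'a multigraph \<Rightarrow> int" where
  "gon r G = (LEAST d. \<exists>D. is_divisor G D \<and> r \<le> rank G D \<and> d = deg G D)"

end

theory Submission
  imports Defs
begin

text \<open>
  Take a complete graph \<open>K\<^sub>a\<close> and attach \<open>b\<close> pendant vertices to one of its vertices, each by a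
  bundle of \<open>M\<close> parallel edges. Effective divisors of degree less than \<open>M\<close> cannot move chips
  across a bundle, so a divisor of rank \<open>r\<close> must carry \<open>r\<close> chips on every pendant vertex, and apart from
  that only \<open>K\<^sub>a\<close> matters. Every cut of \<open>K\<^sub>a\<close> has at least \<open>a - 1\<close> edges, so its gonality is \<open>a - 1\<close>,
  and one chip on each vertex has rank 2. Hence the first two gonalities are \<open>a - 1 + b\<close> and
  \<open>a + 2 b\<close>, and \<open>a = 2 m + 2 - n\<close>, \<open>b = n - m - 1\<close> gives \<open>m\<close> and \<open>n\<close>.
\<close>

section \<open>Linear equivalence and rank\<close>

definition point :: "'a \<Rightarrow> 'a \<Rightarrow> int" where
  "point v w = (if w = v then 1 else 0)"

lemma graph_finite: "graph G \<Longrightarrow> finite (verts G)"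
  by (simp add: graph_def)

lemma graph_edges:
  "graph G \<Longrightarrow> \<forall>e \<in># edges G. \<exists>u \<in> verts G. \<exists>v \<in> verts G. u \<noteq> v \<and> e = {u, v}"
  by (simp add: graph_def)

lemma graph_count_loop:
  assumes "graph G"
  shows "count (edges G) {v, v} = 0"
proof -
  have "{v} \<notin># edges G"
    using graph_edges[OF assms] by (metis doubleton_eq_iff insert_absorb2)
  then show ?thesis
    by (simp add: not_in_iff)
qed

text \<open>An edge at \<open>v\<close> determines its other endpoint, so edges at \<open>v\<close>
  are counted by that endpoint; the term \<open>w = v\<close> is zero because there are no
  loops.\<close>

lemma val_eq_sum:
  assumes G: "graph G" and v: "v \<in> verts G"
  shows "val G v = (\<Sum>w \<in> verts G. count (edges G) {v, w})"
proof -
  let ?F = "{#e \<in># edges G. v \<in> e#}"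
  let ?I = "(\<lambda>w. {v, w}) ` verts G"
  have sub: "set_mset ?F \<subseteq> ?I"
  proof
    fix e assume "e \<in># ?F"
    then have "e \<in># edges G" "v \<in> e" by auto
    then obtain x y where "x \<in> verts G" "y \<in> verts G" "e = {x, y}"
      using bspec[OF graph_edges[OF G] \<open>e \<in># edges G\<close>] by blast
    with \<open>v \<in> e\<close> show "e \<in> ?I" by auto
  qed
  have inj: "inj_on (\<lambda>w. {v, w}) (verts G)"
    by (auto simp: inj_on_def doubleton_eq_iff)
  have "val G v = sum (count ?F) (set_mset ?F)"
    by (simp add: val_def size_multiset_overloaded_eq)
  also have "\<dots> = sum (count ?F) ?I"
    by (rule sum.mono_neutral_left) (use sub graph_finite[OF G] in \<open>auto simp: not_in_iff\<close>)
  also have "\<dots> = (\<Sum>w \<in> verts G. count ?F {v, w})"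
    by (simp add: sum.reindex[OF inj])
  also have "\<dots> = (\<Sum>w \<in> verts G. count (edges G) {v, w})"
    by simp
  finally show ?thesis .
qed

text \<open>The difference form shows that only variation of \<open>f\<close> along edges matters:
  an edge across which \<open>f\<close> is constant moves no chips.\<close>

lemma laplacian_apply:
  assumes G: "graph G" and v: "v \<in> verts G"
  shows "(\<Sum>w \<in> verts G. laplacian G v w * f w)
    = (\<Sum>w \<in> verts G. int (count (edges G) {v, w}) * (f v - f w))"
proof -
  have "(\<Sum>w \<in> verts G. laplacian G v w * f w)
      = (\<Sum>w \<in> verts G. (if w = v then int (val G v) * f v else 0)
          - int (count (edges G) {v, w}) * f w)"
    by (rule sum.cong) (auto simp: laplacian_def graph_count_loop[OF G, simplified])
  also have "\<dots> = int (val G v) * f v - (\<Sum>w \<in> verts G. int (count (edges G) {v, w}) * f w)"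
    using v graph_finite[OF G] by (simp add: sum_subtractf)
  also have "\<dots> = (\<Sum>w \<in> verts G. int (count (edges G) {v, w}) * (f v - f w))"
    by (simp add: val_eq_sum[OF G v] sum_subtractf right_diff_distrib sum_distrib_right)
  finally show ?thesis .
qed

lemma lin_equiv_iff:
  assumes "graph G"
  shows "lin_equiv G D D' \<longleftrightarrow> (\<exists>f. \<forall>v \<in> verts G.
    D v - D' v = (\<Sum>w \<in> verts G. int (count (edges G) {v, w}) * (f v - f w)))"
  unfolding lin_equiv_def using laplacian_apply[OF assms] by simp

lemma lin_equiv_refl: "lin_equiv G D D"
  unfolding lin_equiv_def by (rule exI[of _ "\<lambda>_. 0"]) simp

lemma lin_equiv_sym:
  assumes "lin_equiv G D D'"
  shows "lin_equiv G D' D"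
proof -
  obtain f where "\<forall>v \<in> verts G. D v - D' v = (\<Sum>w \<in> verts G. laplacian G v w * f w)"
    using assms unfolding lin_equiv_def by blast
  then have "\<forall>v \<in> verts G. D' v - D v = (\<Sum>w \<in> verts G. laplacian G v w * (- f w))"
    by (simp add: sum_negf) (metis minus_diff_eq)
  then show ?thesis
    unfolding lin_equiv_def by (intro exI[of _ "\<lambda>w. - f w"])
qed

lemma lin_equiv_add:
  assumes "lin_equiv G A A'" and "lin_equiv G B B'"
  shows "lin_equiv G (\<lambda>v. A v + B v) (\<lambda>v. A' v + B' v)"
proof -
  obtain f g where fg: "\<forall>v \<in> verts G. A v - A' v = (\<Sum>w \<in> verts G. laplacian G v w * f w)"
      "\<forall>v \<in> verts G. B v - B' v = (\<Sum>w \<in> verts G. laplacian G v w * g w)"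
    using assms unfolding lin_equiv_def by blast
  have "A v + B v - (A' v + B' v) = (\<Sum>w \<in> verts G. laplacian G v w * (f w + g w))"
    if "v \<in> verts G" for v
  proof -
    have "A v + B v - (A' v + B' v) = (A v - A' v) + (B v - B' v)"
      by simp
    then show ?thesis
      using fg that by (simp add: distrib_left sum.distrib)
  qed
  then show ?thesis
    unfolding lin_equiv_def by (intro exI[of _ "\<lambda>w. f w + g w"]) blast
qed

lemma lin_equiv_trans:
  assumes "lin_equiv G A B" and "lin_equiv G B C"
  shows "lin_equiv G A C"
proof -
  have "lin_equiv G (\<lambda>v. (A v + B v) + - B v) (\<lambda>v. (B v + C v) + - B v)"
    by (intro lin_equiv_add assms lin_equiv_refl)
  then show ?thesis by simp
qed

lemma deg_add: "deg G (\<lambda>v. D v + E v) = deg G D + deg G E"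
  by (simp add: deg_def sum.distrib)

lemma deg_diff: "deg G (\<lambda>v. D v - E v) = deg G D - deg G E"
  by (simp add: deg_def sum_subtractf)

lemma deg_point: "finite (verts G) \<Longrightarrow> v \<in> verts G \<Longrightarrow> deg G (point v) = 1"
  by (simp add: deg_def point_def)

lemma deg_mult_point: "finite (verts G) \<Longrightarrow> v \<in> verts G \<Longrightarrow> deg G (\<lambda>w. k * point v w) = k"
  using deg_point[of G v] by (simp add: deg_def flip: sum_distrib_left)

lemma effective_mult_point: "v \<in> verts G \<Longrightarrow> 0 \<le> k \<Longrightarrow> effective G (\<lambda>w. k * point v w)"
  by (auto simp: effective_def is_divisor_def point_def)

lemma effective_point: "v \<in> verts G \<Longrightarrow> effective G (point v)"
  by (auto simp: effective_def is_divisor_def point_def)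

lemma effective_add: "effective G D \<Longrightarrow> effective G E \<Longrightarrow> effective G (\<lambda>v. D v + E v)"
  by (simp add: effective_def is_divisor_def)

text \<open>Edge multiplicities are symmetric, so what an edge contributes at one endpoint cancels
  what it contributes at the other.\<close>

lemma deg_lin_equiv:
  assumes G: "graph G" and "lin_equiv G D D'"
  shows "deg G D = deg G D'"
proof -
  let ?c = "\<lambda>v w. int (count (edges G) {v, w})"
  obtain f where f: "\<forall>v \<in> verts G. D v - D' v = (\<Sum>w \<in> verts G. ?c v w * (f v - f w))"
    using assms lin_equiv_iff by blast
  have "deg G D - deg G D' = (\<Sum>v \<in> verts G. \<Sum>w \<in> verts G. ?c v w * (f v - f w))"
    using f by (simp add: deg_def flip: sum_subtractf)
  also have "\<dots> = (\<Sum>v \<in> verts G. \<Sum>w \<in> verts G. ?c v w * f v)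
      - (\<Sum>v \<in> verts G. \<Sum>w \<in> verts G. ?c v w * f w)"
    by (simp add: right_diff_distrib sum_subtractf)
  also have "(\<Sum>v \<in> verts G. \<Sum>w \<in> verts G. ?c v w * f w)
      = (\<Sum>v \<in> verts G. \<Sum>w \<in> verts G. ?c v w * f v)"
    by (subst sum.swap) (simp add: insert_commute)
  finally show ?thesis by simp
qed

lemma effective_le_deg:
  assumes "finite (verts G)" and "effective G D" and "v \<in> verts G"
  shows "D v \<le> deg G D"
  unfolding deg_def using assms by (intro member_le_sum) (auto simp: effective_def)

lemma equiv_effective_add:
  assumes "equiv_effective G D" and "effective G E"
  shows "equiv_effective G (\<lambda>v. D v + E v)"
  using assms unfolding equiv_effective_def
  by (metis effective_add lin_equiv_add lin_equiv_refl)

lemma equiv_effective_deg_nonneg: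
  assumes "graph G" and "equiv_effective G D"
  shows "0 \<le> deg G D"
proof -
  obtain D' where "effective G D'" "lin_equiv G D D'"
    using assms unfolding equiv_effective_def by blast
  then have "deg G D = deg G D'" "0 \<le> deg G D'"
    using deg_lin_equiv[OF assms(1)] by (auto simp: deg_def effective_def intro: sum_nonneg)
  then show ?thesis by simp
qed

text \<open>Turns a rank condition into an effective representative of \<open>D\<close> that
  contains \<open>E\<close>, the form used in all lower bounds.\<close>

lemma equiv_effective_diffD:
  assumes "equiv_effective G (\<lambda>v. D v - E v)"
  obtains F where "effective G F" "lin_equiv G D (\<lambda>v. F v + E v)"
proof -
  obtain F where F: "effective G F" "lin_equiv G (\<lambda>v. D v - E v) F"
    using assms unfolding equiv_effective_def by blast
  have "lin_equiv G (\<lambda>v. D v - E v + E v) (\<lambda>v. F v + E v)"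
    by (intro lin_equiv_add F lin_equiv_refl)
  then show ?thesis using F that by simp
qed

text \<open>The admissible values \<open>s\<close> are closed downwards: pad a smaller
  \<open>E\<close> with chips at a fixed vertex \<open>x\<close> and give them back afterwards. They
  are bounded by \<open>deg G D\<close>, and 0 is admissible exactly when \<open>D\<close> is
  equivalent to an effective divisor. So the greatest one is the maximum of a finite initial
  segment.\<close>

lemma le_rank_iff:
  assumes G: "graph G" and r: "0 \<le> r"
  shows "r \<le> rank G D \<longleftrightarrow>
    (\<forall>E. effective G E \<and> deg G E = r \<longrightarrow> equiv_effective G (\<lambda>v. D v - E v))"
proof -
  define Q where "Q s \<longleftrightarrow>
    (\<forall>E. effective G E \<and> deg G E = s \<longrightarrow> equiv_effective G (\<lambda>v. D v - E v))" for s
  obtain x where x: "x \<in> verts G" using G by (auto simp: graph_def)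
  note fin = graph_finite[OF G]
  have mono: "Q s" if "Q t" "s \<le> t" for s t
    unfolding Q_def
  proof (intro allI impI)
    fix E assume E: "effective G E \<and> deg G E = s"
    let ?P = "\<lambda>v. (t - s) * point x v"
    have P: "effective G ?P" using x that by (intro effective_mult_point) auto
    have "effective G (\<lambda>v. E v + ?P v) \<and> deg G (\<lambda>v. E v + ?P v) = t"
      using E P effective_add[OF _ P] deg_mult_point[OF fin x] by (simp add: deg_add)
    then have "equiv_effective G (\<lambda>v. D v - (E v + ?P v))"
      using \<open>Q t\<close> unfolding Q_def by blast
    from equiv_effective_add[OF this P] show "equiv_effective G (\<lambda>v. D v - E v)"
      by (simp add: algebra_simps)
  qed
  have Q0: "Q 0 \<longleftrightarrow> equiv_effective G D"
  proof
    assume "Q 0"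
    moreover have "effective G (\<lambda>v. 0) \<and> deg G (\<lambda>v. 0) = 0"
      by (simp add: effective_def is_divisor_def deg_def)
    ultimately have "equiv_effective G (\<lambda>v. D v - 0)" unfolding Q_def by blast
    then show "equiv_effective G D" by simp
  next
    assume D: "equiv_effective G D"
    show "Q 0" unfolding Q_def
    proof (intro allI impI)
      fix E assume E: "effective G E \<and> deg G E = 0"
      then have "E v = 0" for v
        using fin by (cases "v \<in> verts G")
          (auto simp: effective_def is_divisor_def deg_def sum_nonneg_eq_0_iff)
      then show "equiv_effective G (\<lambda>v. D v - E v)" using D by simp
    qed
  qed
  have bound: "s \<le> deg G D" if "Q s" "0 \<le> s" for s
  proof -
    have "equiv_effective G (\<lambda>v. D v - s * point x v)"
      using that effective_mult_point[OF x] deg_mult_point[OF fin x] unfolding Q_def by blast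
    then have "0 \<le> deg G (\<lambda>v. D v - s * point x v)"
      by (rule equiv_effective_deg_nonneg[OF G])
    then show ?thesis by (simp add: deg_diff deg_mult_point[OF fin x])
  qed
  show ?thesis
  proof (cases "equiv_effective G D")
    case False
    then have "\<not> Q r" using mono[OF _ r] Q0 by blast
    then show ?thesis using False r by (simp add: rank_def Q_def)
  next
    case True
    let ?S = "{s. 0 \<le> s \<and> Q s}"
    have "?S \<subseteq> {0..deg G D}" using bound by auto
    then have S: "finite ?S" "?S \<noteq> {}"
      using True Q0 by (auto intro: finite_subset)
    have "(GREATEST s. 0 \<le> s \<and> Q s) = Max ?S"
      by (rule Greatest_equality) (use S Max_in[OF S] in auto)
    then have rank: "rank G D = Max ?S"
      using True by (simp add: rank_def Q_def)
    have "r \<le> Max ?S \<longleftrightarrow> Q r"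
      using S Max_in[OF S] mono r by (auto intro: Max_ge)
    then show ?thesis by (simp add: rank Q_def)
  qed
qed

section \<open>A complete graph with thick pendant edges\<close>

text \<open>Vertices below \<open>a\<close> form the complete part; each vertex from
  \<open>a\<close> on hangs on vertex 0 by \<open>M\<close> parallel edges.\<close>

definition thick :: "nat \<Rightarrow> nat \<Rightarrow> nat \<Rightarrow> nat set \<Rightarrow> nat" where
  "thick a b M e = (if e \<subseteq> {..<a} then 1 else if 0 \<in> e then M else 0)"

text \<open>The sum ranges over a set of unordered pairs, so no edge is counted once per
  orientation.\<close>

definition pendant_complete :: "nat \<Rightarrow> nat \<Rightarrow> nat \<Rightarrow> nat multigraph" where
  "pendant_complete a b M = \<lparr>verts = {..<a + b},
     edges = (\<Sum>e \<in> {{u, v} | u v. u < a + b \<and> v < a + b \<and> u \<noteq> v}. replicate_mset (thick a b M e) e)\<rparr>"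

context
  fixes a b M :: nat and G :: "nat multigraph"
  assumes a: "2 \<le> a" and M: "0 < M"
  defines "G \<equiv> pendant_complete a b M"
begin

lemma verts_G: "verts G = {..<a + b}"
  by (simp add: G_def pendant_complete_def)

lemma count_edges_G:
  "count (edges G) e =
    (if \<exists>u v. u < a + b \<and> v < a + b \<and> u \<noteq> v \<and> e = {u, v} then thick a b M e else 0)"
proof -
  let ?P = "{{u, v} | u v. u < a + b \<and> v < a + b \<and> u \<noteq> v}"
  have "?P \<subseteq> Pow {..<a + b}" by auto
  then have fin: "finite ?P" by (rule finite_subset) simp
  have "count (edges G) e = (\<Sum>e' \<in> ?P. if e' = e then thick a b M e' else 0)"
    by (simp add: G_def pendant_complete_def count_sum eq_commute[of e])
  also have "\<dots> = (if e \<in> ?P then thick a b M e else 0)"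
    using fin by simp
  finally show ?thesis by (auto intro!: if_cong)
qed

lemma count_doubleton_G:
  assumes "u < a + b" "v < a + b"
  shows "count (edges G) {u, v} =
    (if u = v then 0 else if u < a \<and> v < a then 1 else if u = 0 \<or> v = 0 then M else 0)"
proof -
  have "(\<exists>x y. x < a + b \<and> y < a + b \<and> x \<noteq> y \<and> {u, v} = {x, y}) \<longleftrightarrow> u \<noteq> v"
    using assms by (auto simp: doubleton_eq_iff)
  then show ?thesis
    unfolding count_edges_G by (auto simp: thick_def)
qed

lemma graph_G: "graph G"
  unfolding graph_def
proof (intro conjI ballI)
  show "finite (verts G)" "verts G \<noteq> {}"
    using a by (auto simp: verts_G lessThan_empty_iff)
  fix e assume "e \<in># edges G"
  then have "count (edges G) e \<noteq> 0" by simp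
  then show "\<exists>u \<in> verts G. \<exists>v \<in> verts G. u \<noteq> v \<and> e = {u, v}"
    unfolding count_edges_G verts_G by (metis lessThan_iff)
next
  have adj: "(u, v) \<in> adjacency G" if "u < a + b" "v < a + b" "u \<noteq> v" "u = 0 \<or> v = 0" for u v
  proof -
    have "count (edges G) {u, v} \<noteq> 0"
      using that M by (auto simp: count_doubleton_G)
    then show ?thesis by (simp add: adjacency_def)
  qed
  fix u v assume "u \<in> verts G" "v \<in> verts G"
  then have uv: "u < a + b" "v < a + b" "0 < a + b" using a by (auto simp: verts_G)
  have "(u, 0) \<in> (adjacency G)\<^sup>*" using adj[of u 0] uv by (cases "u = 0") auto
  moreover have "(0, v) \<in> (adjacency G)\<^sup>*" using adj[of 0 v] uv by (cases "v = 0") auto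
  ultimately show "(u, v) \<in> (adjacency G)\<^sup>*" by (rule rtrancl_trans)
qed

section \<open>Chip firing on the graph and lower bounds for degrees\<close>

lemma deg_G: "deg G D = (\<Sum>v<a. D v) + (\<Sum>v = a..<a + b. D v)"
  unfolding deg_def verts_G lessThan_atLeast0 by (rule sum.atLeastLessThan_concat[symmetric]) auto

lemma laplace_pendant:
  assumes "a \<le> t" "t < a + b"
  shows "(\<Sum>w \<in> verts G. int (count (edges G) {t, w}) * (f t - f w)) = int M * (f t - f 0)"
proof -
  have "(\<Sum>w \<in> verts G. int (count (edges G) {t, w}) * (f t - f w))
      = (\<Sum>w \<in> verts G. if w = 0 then int M * (f t - f 0) else 0)"
    using assms a by (intro sum.cong) (auto simp: verts_G count_doubleton_G)
  then show ?thesis using a by (simp add: verts_G)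
qed

text \<open>Bundles meet the complete part only at 0, and there the hypothesis on \<open>f\<close>
  cancels their terms.\<close>

lemma laplace_complete:
  assumes u: "u < a" and f: "\<And>t. a \<le> t \<Longrightarrow> t < a + b \<Longrightarrow> f t = f 0"
  shows "(\<Sum>w \<in> verts G. int (count (edges G) {u, w}) * (f u - f w)) = (\<Sum>w<a. f u - f w)"
proof -
  have "(\<Sum>w \<in> verts G. int (count (edges G) {u, w}) * (f u - f w))
      = (\<Sum>w \<in> verts G. if w < a then f u - f w else 0)"
    using u f by (intro sum.cong) (auto simp: verts_G count_doubleton_G)
  also have "\<dots> = (\<Sum>w<a. f u - f w)"
    by (rule sum.mono_neutral_cong_right) (auto simp: verts_G)
  finally show ?thesis .
qed

text \<open>A chip moved across a bundle forces \<open>M\<close> chips to move, which \<open>deg G D < M\<close> rules out.\<close>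

lemma firing_constant_on_pendant:
  assumes "effective G D" "effective G D'" "deg G D < int M" "lin_equiv G D D'"
  obtains f where "\<And>t. a \<le> t \<Longrightarrow> t < a + b \<Longrightarrow> D' t = D t"
    and "\<And>u. u < a \<Longrightarrow> D u - D' u = (\<Sum>w<a. f u - f w)"
proof -
  obtain f where f: "\<And>v. v \<in> verts G \<Longrightarrow>
      D v - D' v = (\<Sum>w \<in> verts G. int (count (edges G) {v, w}) * (f v - f w))"
    using assms(4) lin_equiv_iff[OF graph_G] by blast
  have const: "f t = f 0" if t: "a \<le> t" "t < a + b" for t
  proof (rule ccontr)
    assume "f t \<noteq> f 0"
    \<comment> \<open>Since \<open>f\<close> is integral, \<open>D t\<close> and \<open>D' t\<close>
      differ by at least \<open>M\<close>, although both lie between 0 and the common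
      degree.\<close>
    then have "1 \<le> \<bar>f t - f 0\<bar>" by linarith
    then have "int M * 1 \<le> int M * \<bar>f t - f 0\<bar>" by (intro mult_left_mono) auto
    moreover have "D t - D' t = int M * (f t - f 0)"
      using f laplace_pendant[OF t] t by (simp add: verts_G)
    ultimately have "int M \<le> \<bar>D t - D' t\<bar>" by (simp add: abs_mult)
    moreover have "t \<in> verts G" using t by (simp add: verts_G)
    then have "0 \<le> D t" "0 \<le> D' t" "D t \<le> deg G D" "D' t \<le> deg G D'"
      using assms(1,2) effective_le_deg[OF graph_finite[OF graph_G]] by (auto simp: effective_def)
    moreover have "deg G D = deg G D'" by (rule deg_lin_equiv[OF graph_G assms(4)])
    ultimately show False using assms(3) by linarith
  qed
  show ?thesis
  proof (rule that)
    show "D' t = D t" if t: "a \<le> t" "t < a + b" for t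
      proof -
      have "D t - D' t = int M * (f t - f 0)"
        using f laplace_pendant[OF t] t by (simp add: verts_G)
      then show ?thesis using const[OF t] by simp
    qed
    show "D u - D' u = (\<Sum>w<a. f u - f w)" if u: "u < a" for u
      using f[of u] laplace_complete[of u f, OF u const] u by (simp add: verts_G)
  qed
qed

text \<open>Let \<open>S\<close> be the set of vertices of the complete part where \<open>f\<close>
  is maximal. Each of them sends at least one chip to every vertex of that part outside
  \<open>S\<close>, so \<open>D\<close> has at least \<open>card S * (a - card S)\<close> chips
  there. For a proper nonempty \<open>S\<close> this is at least \<open>a - 1\<close>, too many;
  hence \<open>f\<close> is constant on the complete part.\<close>

lemma effective_unique_on_complete:
  assumes "effective G D" "effective G D'" "deg G D < int M" "lin_equiv G D D'"
    and small: "(\<Sum>v<a. D v) < int a - 1" and u: "u < a"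
  shows "D' u = D u"
proof -
  obtain f where f: "\<And>u. u < a \<Longrightarrow> D u - D' u = (\<Sum>w<a. f u - f w)"
    using firing_constant_on_pendant[OF assms(1-4)] by metis
  have nonneg: "0 \<le> D v" "0 \<le> D' v" if "v < a" for v
    using assms(1,2) that by (auto simp: effective_def verts_G)
  define m where "m = Max (f ` {..<a})"
  define S where "S = {v. v < a \<and> f v = m}"
  have le_m: "f v \<le> m" if "v < a" for v
    using that unfolding m_def by (intro Max_ge) auto
  have "m \<in> f ` {..<a}"
    unfolding m_def using a by (intro Max_in) (auto simp: lessThan_empty_iff)
  then have S: "S \<noteq> {}" "S \<subseteq> {..<a}" "finite S" by (auto simp: S_def)
  then have card: "1 \<le> card S" "card S \<le> a"
    using card_mono[of "{..<a}" S] by (auto simp: card_gt_0_iff Suc_le_eq)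
  have "int a - int (card S) \<le> D v" if "v \<in> S" for v
  proof -
    have "int a - int (card S) = (\<Sum>w \<in> {..<a} - S. 1)"
      using S card by (simp add: card_Diff_subset)
    also have "\<dots> \<le> (\<Sum>w \<in> {..<a} - S. f v - f w)"
    proof (rule sum_mono)
      fix w assume "w \<in> {..<a} - S"
      then show "1 \<le> f v - f w" using that le_m[of w] by (auto simp: S_def)
    qed
    also have "\<dots> \<le> (\<Sum>w<a. f v - f w)"
      using that le_m by (intro sum_mono2) (auto simp: S_def)
    finally show ?thesis using f[of v] nonneg[of v] that by (simp add: S_def)
  qed
  then have "int (card S) * (int a - int (card S)) \<le> (\<Sum>v \<in> S. D v)"
    using sum_bounded_below[of S "int a - int (card S)" D] by simp
  also have "\<dots> \<le> (\<Sum>v<a. D v)"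
    using S nonneg by (intro sum_mono2) auto
  finally have *: "int (card S) * (int a - int (card S)) < int a - 1"
    using small by simp
  have "card S = a"
  proof (rule ccontr)
    assume "card S \<noteq> a"
    \<comment> \<open>Expanded, this product is
      \<open>card S * (a - card S) - (a - 1)\<close>.\<close>
    then have "0 \<le> (int (card S) - 1) * (int a - int (card S) - 1)"
      using card by simp
    then show False using * by (simp add: algebra_simps)
  qed
  then have "S = {..<a}" using S by (intro card_subset_eq) auto
  then have "f w = m" if "w < a" for w using that by (auto simp: S_def)
  then have "(\<Sum>w<a. f u - f w) = 0" using u by simp
  then show ?thesis using f[OF u] by simp
qed

text \<open>Fix one effective representative \<open>A\<close>. Its values on pendant vertices are
  forced, which uses up \<open>k * b\<close> chips. If the bound failed, fewer than
  \<open>a - 1\<close> chips would remain on the complete part, so the values there would be forced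
  as well, and \<open>A\<close> would need a chip on each of those \<open>a\<close>
  vertices.\<close>

lemma deg_lower_bound:
  assumes M_large: "deg G D < int M"
    and K: "\<And>u. u < a \<Longrightarrow> equiv_effective G (\<lambda>v. D v - point u v)"
    and T: "\<And>t. a \<le> t \<Longrightarrow> t < a + b \<Longrightarrow> \<exists>F. effective G F \<and> lin_equiv G D F \<and> k \<le> F t"
  shows "int a - 1 + k * int b \<le> deg G D"
proof (rule ccontr)
  assume "\<not> ?thesis"
  then have d: "deg G D < int a - 1 + k * int b" by simp
  have rep: "\<exists>F. effective G F \<and> lin_equiv G D F \<and> 1 \<le> F u" if "u < a" for u
  proof -
    obtain F where F: "effective G F" "lin_equiv G D (\<lambda>v. F v + point u v)"
      using equiv_effective_diffD[OF K[OF \<open>u < a\<close>]] .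
    have "u \<in> verts G" using that by (simp add: verts_G)
    moreover from this have "0 \<le> F u" using F by (simp add: effective_def)
    ultimately show ?thesis
      using F effective_add[OF F(1) effective_point[OF \<open>u \<in> verts G\<close>]]
      by (intro exI[of _ "\<lambda>v. F v + point u v"]) (simp add: point_def)
  qed
  obtain A where A: "effective G A" "lin_equiv G D A"
    using rep[of 0] a by auto
  then have deg: "deg G A = deg G D" using deg_lin_equiv[OF graph_G] by metis
  have AF: "lin_equiv G A F" if "lin_equiv G D F" for F
    using A that lin_equiv_sym lin_equiv_trans by metis
  have "k \<le> A t" if t: "a \<le> t" "t < a + b" for t
  proof -
    obtain F where F: "effective G F" "lin_equiv G D F" "k \<le> F t" using T[OF t] by blast
    then have "F t = A t"
      using firing_constant_on_pendant[OF A(1) F(1) _ AF] M_large deg t by metis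
    then show ?thesis using F by simp
  qed
  then have "k * int b \<le> (\<Sum>t = a..<a + b. A t)"
    using sum_bounded_below[of "{a..<a + b}" k A] by (simp add: mult.commute)
  then have small: "(\<Sum>v<a. A v) < int a - 1"
    using d deg deg_G[of A] by simp
  have "1 \<le> A u" if u: "u < a" for u
  proof -
    obtain F where F: "effective G F" "lin_equiv G D F" "1 \<le> F u" using rep[OF u] by blast
    then have "F u = A u"
      using effective_unique_on_complete[OF A(1) F(1) _ AF small u] M_large deg by simp
    then show ?thesis using F by simp
  qed
  then have "int a \<le> (\<Sum>v<a. A v)"
    using sum_bounded_below[of "{..<a}" 1 A] by simp
  then show False using small by simp
qed

section \<open>Borrowing in the complete part and divisors of given rank\<close>

lemma borrow_lin_equiv:
  assumes v: "v < a"
  shows "lin_equiv G D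
    (\<lambda>w. if w = v then D w + (int a - 1) else if w < a then D w - 1 else D w)"
    (is "lin_equiv G D ?D'")
proof -
  \<comment> \<open>Vertex \<open>v\<close> borrows once. If \<open>v = 0\<close>, the pendant
    vertices borrow along with it, so that no chips cross a bundle.\<close>
  define f :: "nat \<Rightarrow> int" where "f w = (if w = v \<or> v = 0 \<and> a \<le> w then - 1 else 0)" for w
  have f: "f t = f 0" if "a \<le> t" for t using that v by (auto simp: f_def)
  have "(\<Sum>w<a. f w) = (\<Sum>w<a. if w = v then - 1 else 0)"
    by (rule sum.cong) (auto simp: f_def)
  then have sum: "(\<Sum>w<a. f w) = - 1" using v by simp
  have "D w - ?D' w = (\<Sum>x \<in> verts G. int (count (edges G) {w, x}) * (f w - f x))"
    if "w \<in> verts G" for w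
  proof (cases "w < a")
    case True
    have "(\<Sum>x<a. f w - f x) = int a * f w + 1" by (simp add: sum_subtractf sum)
    then show ?thesis using True f by (subst laplace_complete) (auto simp: f_def)
  next
    case False
    then have "a \<le> w" "w < a + b" using that by (auto simp: verts_G)
    then show ?thesis using False f v by (subst laplace_pendant) auto
  qed
  then show ?thesis using lin_equiv_iff[OF graph_G] by blast
qed

text \<open>
  If \<open>E\<close> overdraws \<open>D\<close> anywhere, then it is concentrated at a single vertex \<open>v\<close> of the complete
  part, and \<open>v\<close> can borrow one chip from every other vertex of that part.
\<close>

lemma le_rankI:
  assumes r: "0 \<le> r" and D: "is_divisor G D" "\<And>t. a \<le> t \<Longrightarrow> t < a + b \<Longrightarrow> r \<le> D t"
    and K: "\<And>v. v < a \<Longrightarrow> D v < r \<Longrightarrow> r \<le> D v + (int a - 1) \<and> (\<forall>w < a. w \<noteq> v \<longrightarrow> 1 \<le> D w)"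
    and K': "\<And>v. v < a \<Longrightarrow> r - 1 \<le> D v"
  shows "r \<le> rank G D"
  unfolding le_rank_iff[OF graph_G r]
proof (intro allI impI)
  fix E assume E: "effective G E \<and> deg G E = r"
  then have E0: "0 \<le> E w" "E w \<le> r" if "w < a + b" for w
  proof -
    have "w \<in> verts G" using that by (simp add: verts_G)
    then show "0 \<le> E w" "E w \<le> r"
      using E effective_le_deg[OF graph_finite[OF graph_G], of E w] by (simp_all add: effective_def)
  qed
  show "equiv_effective G (\<lambda>v. D v - E v)"
  proof (cases "\<forall>v < a + b. E v \<le> D v")
    case True
    then have "effective G (\<lambda>v. D v - E v)"
      using E D by (auto simp: effective_def is_divisor_def verts_G)
    then show ?thesis unfolding equiv_effective_def using lin_equiv_refl by blast
  next
    case False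
    then obtain v where v: "v < a + b" "D v < E v" by auto
    \<comment> \<open>A pendant vertex holds at least \<open>r\<close> chips and cannot be
      overdrawn. In the complete part \<open>r - 1 <= D v < E v <= r\<close> then forces
      \<open>E v = r\<close>, leaving no degree for other vertices.\<close>
    then have va: "v < a" using D(2)[of v] E0[of v] by linarith
    then have Ev: "E v = r" using K'[of v] E0[of v] v by linarith
    have Ew: "E w = 0" if "w < a + b" "w \<noteq> v" for w
    proof -
      have "E v + E w = sum E {v, w}" using that by auto
      also have "\<dots> \<le> deg G E"
        unfolding deg_def using that v E0 by (intro sum_mono2) (auto simp: verts_G)
      finally show ?thesis using E Ev E0[OF that(1)] by simp
    qed
    let ?D = "\<lambda>w. D w - E w"
    let ?D' = "\<lambda>w. if w = v then ?D w + (int a - 1) else if w < a then ?D w - 1 else ?D w"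
    have "0 \<le> ?D' w" if "w < a + b" for w
      using K[OF va] v Ev Ew[OF that] D(2)[of w] r that by (cases "w < a") auto
    moreover have "?D' w = 0" if "\<not> w < a + b" for w
      using that va D E by (auto simp: effective_def is_divisor_def verts_G)
    ultimately have "effective G ?D'"
      by (simp add: effective_def is_divisor_def verts_G)
    then show ?thesis
      unfolding equiv_effective_def using borrow_lin_equiv[OF va, of ?D] by blast
  qed
qed

section \<open>The first and second gonality\<close>

lemma gon_1_G:
  assumes "a + b \<le> M"
  shows "gon 1 G = int a - 1 + int b"
  unfolding gon_def
proof (rule Least_equality)
  \<comment> \<open>Only vertex 0 lacks a chip, and it can borrow \<open>a - 1 >= 1\<close> chips
    from the rest of the complete part.\<close>
  let ?D = "\<lambda>v. if 0 < v \<and> v < a + b then 1 else 0 :: int"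
  have "1 \<le> rank G ?D"
    using a by (intro le_rankI) (auto simp: is_divisor_def verts_G)
  moreover have "(\<Sum>v<a. ?D v) = (\<Sum>v \<in> {..<a} - {0}. 1)"
    by (rule sum.mono_neutral_cong_right) auto
  then have "deg G ?D = int a - 1 + int b"
    using a by (simp add: deg_G)
  ultimately show "\<exists>D. is_divisor G D \<and> 1 \<le> rank G D \<and> int a - 1 + int b = deg G D"
    by (intro exI[of _ ?D]) (auto simp: is_divisor_def verts_G)
next
  fix d assume "\<exists>D. is_divisor G D \<and> 1 \<le> rank G D \<and> d = deg G D"
  then obtain D where D: "1 \<le> rank G D" "d = deg G D" by blast
  have sub: "equiv_effective G (\<lambda>v. D v - point u v)" if "u < a + b" for u
    using D(1) effective_point[of u G] deg_point[OF graph_finite[OF graph_G], of u] that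
    by (auto simp: le_rank_iff[OF graph_G] verts_G)
  show "int a - 1 + int b \<le> d"
  \<comment> \<open>Arguing by contradiction supplies \<open>deg G D < int M\<close>, without which
    chips could cross a bundle.\<close>
  proof (rule ccontr)
    assume less: "\<not> ?thesis"
    have "int a - 1 + 1 * int b \<le> deg G D"
    proof (rule deg_lower_bound)
      show "deg G D < int M" using assms less D by simp
      show "equiv_effective G (\<lambda>v. D v - point u v)" if "u < a" for u using sub that by simp
      fix t assume t: "a \<le> t" "t < a + b"
      then have tG: "t \<in> verts G" by (simp add: verts_G)
      obtain F where F: "effective G F" "lin_equiv G D (\<lambda>v. F v + point t v)"
        using equiv_effective_diffD[OF sub[OF t(2)]] .
      moreover have "0 \<le> F t" using F tG by (simp add: effective_def)
      ultimately show "\<exists>F. effective G F \<and> lin_equiv G D F \<and> 1 \<le> F t"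
        using effective_add[OF F(1) effective_point[OF tG]]
        by (intro exI[of _ "\<lambda>v. F v + point t v"]) (simp add: point_def)
    qed
    then show False using less D by simp
  qed
qed

lemma gon_2_G:
  assumes "a + 2 * b \<le> M"
  shows "gon 2 G = int a + 2 * int b"
  unfolding gon_def
proof (rule Least_equality)
  \<comment> \<open>If two chips are demanded at one vertex of the complete part, borrowing raises
    its single chip to \<open>a >= 2\<close>.\<close>
  let ?D = "\<lambda>v. if v < a then 1 else if v < a + b then 2 else 0 :: int"
  have "2 \<le> rank G ?D"
    using a by (intro le_rankI) (auto simp: is_divisor_def verts_G)
  moreover have "deg G ?D = int a + 2 * int b"
    by (simp add: deg_G)
  ultimately show "\<exists>D. is_divisor G D \<and> 2 \<le> rank G D \<and> int a + 2 * int b = deg G D"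
    by (intro exI[of _ ?D]) (auto simp: is_divisor_def verts_G)
next
  fix d assume "\<exists>D. is_divisor G D \<and> 2 \<le> rank G D \<and> d = deg G D"
  then obtain D where D: "2 \<le> rank G D" "d = deg G D" by blast
  note fin = graph_finite[OF graph_G]
  have sub: "equiv_effective G (\<lambda>v. D v - (point u v + point w v))"
    if "u < a + b" "w < a + b" for u w
  proof -
    have "u \<in> verts G" "w \<in> verts G" using that by (auto simp: verts_G)
    then have "effective G (\<lambda>v. point u v + point w v)" "deg G (\<lambda>v. point u v + point w v) = 2"
      by (auto simp: deg_add deg_point[OF fin] intro: effective_add effective_point)
    then show ?thesis using D(1) by (simp add: le_rank_iff[OF graph_G])
  qed
  \<comment> \<open>After one chip is taken at 0, a chip can still be demanded at any vertex of the
    complete part. The lower bound \<open>a - 1 + 2 * b\<close> for the remaining degree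
    \<open>d - 1\<close> gives the claim.\<close>
  let ?D = "\<lambda>v. D v - point 0 v"
  have zero: "0 < a + b" "0 \<in> verts G" using a by (auto simp: verts_G)
  have deg: "deg G ?D = d - 1" using D zero by (simp add: deg_diff deg_point[OF fin])
  show "int a + 2 * int b \<le> d"
  proof (rule ccontr)
    assume less: "\<not> ?thesis"
    then have dM: "d < int M" using assms by simp
    have "int a - 1 + 2 * int b \<le> deg G ?D"
    proof (rule deg_lower_bound)
      show "deg G ?D < int M" using dM deg by simp
      show "equiv_effective G (\<lambda>v. ?D v - point u v)" if "u < a" for u
        using sub[OF zero(1), of u] that by (simp add: algebra_simps)
      fix t assume t: "a \<le> t" "t < a + b"
      then have tG: "t \<in> verts G" and t0: "t \<noteq> 0" using a by (auto simp: verts_G)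
      \<comment> \<open>One representative of \<open>D\<close> has chips at 0 and \<open>t\<close>,
        another has two chips at \<open>t\<close>. Their values at \<open>t\<close> agree, so the
        first also has two chips at \<open>t\<close>, and keeps them when the chip at 0 is
        removed.\<close>
      obtain E where E: "effective G E" "lin_equiv G D (\<lambda>v. E v + (point 0 v + point t v))"
        using equiv_effective_diffD[OF sub[OF zero(1) t(2)]] .
      obtain F where F: "effective G F" "lin_equiv G D (\<lambda>v. F v + (point t v + point t v))"
        using equiv_effective_diffD[OF sub[OF t(2) t(2)]] .
      let ?E = "\<lambda>v. E v + (point 0 v + point t v)" and ?F = "\<lambda>v. F v + (point t v + point t v)"
      have eff: "effective G ?E" "effective G ?F"
        by (intro effective_add E F effective_point tG zero)+
      have "deg G ?E < int M"
        using dM D deg_lin_equiv[OF graph_G E(2)] by simp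
      then have "?F t = ?E t"
        using firing_constant_on_pendant[OF eff _ lin_equiv_trans[OF lin_equiv_sym[OF E(2)] F(2)]] t
        by metis
      moreover have "0 \<le> F t" using F tG by (simp add: effective_def)
      ultimately have "2 \<le> E t + point t t" using t0 by (simp add: point_def)
      moreover have "lin_equiv G (\<lambda>v. D v + - point 0 v) (\<lambda>v. ?E v + - point 0 v)"
        by (intro lin_equiv_add E lin_equiv_refl)
      then have "lin_equiv G ?D (\<lambda>v. E v + point t v)" by (simp add: algebra_simps)
      moreover have "effective G (\<lambda>v. E v + point t v)"
        by (intro effective_add E effective_point tG)
      ultimately show "\<exists>F. effective G F \<and> lin_equiv G ?D F \<and> 2 \<le> F t" by blast
    qed
    then show False using less deg by simp
  qed
qed

end

theorem theorem1p5:
  fixes m n :: int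
  assumes "1 \<le> m" and "m < n" and "n \<le> 2 * m"
  shows "\<exists>G :: nat multigraph. graph G \<and> gon 1 G = m \<and> gon 2 G = n"
proof -
  \<comment> \<open>The solution of \<open>a - 1 + b = m\<close> and \<open>a + 2 * b = n\<close>;
    here \<open>n <= 2 * m\<close> gives \<open>a >= 2\<close>, and \<open>m < n\<close> gives
    \<open>n - m - 1 >= 0\<close>, so \<open>nat\<close> truncates nothing.\<close>
  define a b where "a = nat (2 * m + 2 - n)" and "b = nat (n - m - 1)"
  have ab: "2 \<le> a" "int a = 2 * m + 2 - n" "int b = n - m - 1" "0 < a + 2 * b"
    using assms by (auto simp: a_def b_def)
  \<comment> \<open>Bundle size \<open>a + 2 * b\<close> meets the requirements of both gonality
    computations.\<close>
  let ?G = "pendant_complete a b (a + 2 * b)"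
  have "graph ?G" by (rule graph_G[OF ab(1,4)])
  moreover have "gon 1 ?G = int a - 1 + int b" by (rule gon_1_G[OF ab(1,4)]) simp
  moreover have "gon 2 ?G = int a + 2 * int b" by (rule gon_2_G[OF ab(1,4)]) simp
  ultimately show ?thesis using ab(2,3) by (intro exI[of _ ?G] conjI) linarith+
qed

end
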